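(* For all integers $n\ge 2$ and $0\le m\le\binom n2$, \[ d(n,0,m)=\begin{cases} n-m & \text{if } 0\le m<n-1,\\ 1 & \text{if } n-1\le m\le\binom n2.\end{cases} \]
   Context: All graphs are finite and simple. For a vertex $u$ of a graph $G$, $N[u]$ is its closed neighborhood (the set consisting of $u$ and all vertices adjacent to $u$). A set $S\subseteq V(G)$ is dominating if every vertex of $G$ lies in $N[s]$ for some $s\in S$. A vertex $u\in V(G)$ is overdominated by $S$ if $|N[u]\cap S|\ge 2$. The cardinality-redundance $CR(S)$ is the number of vertices of $G$ overdominated by $S$, and $CR(G)$ is the minimum of $CR(S)$ over all dominating sets $S$ of $G$. $\gamma_{CR}(G)$ is the minimum size of a dominating set $S$ with $CR(S)=CR(G)$. For integers $n\ge 1$, $0\le k\le n$ and $0\le m\le\binom n2$, $d(n,k,m)$ is the minimum of $\gamma_{CR}(G)$ over all graphs $G$ with $n$ vertices, $m$ edges and $CR(G)=k$; if no such graph exists, $d(n,k,m)=0$. *)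

theory Defs
  imports Complex_Main
begin

text \<open>A finite simple graph is given by its vertex set \<open>V\<close> and its set \<open>E\<close> of edges, each edge being
  a two-element subset of \<open>V\<close>.\<close>

definition simple_graph :: "'a set \<Rightarrow> 'a set set \<Rightarrow> bool" where
  "simple_graph V E \<longleftrightarrow> finite V \<and> (\<forall>e\<in>E. e \<subseteq> V \<and> card e = 2)"

definition closed_nbhd :: "'a set set \<Rightarrow> 'a \<Rightarrow> 'a set" where
  "closed_nbhd E u = insert u {v. {u, v} \<in> E}"

definition dominating :: "'a set \<Rightarrow> 'a set set \<Rightarrow> 'a set \<Rightarrow> bool" where
  "dominating V E S \<longleftrightarrow> S \<subseteq> V \<and> (\<forall>v\<in>V. \<exists>s\<in>S. v \<in> closed_nbhd E s)"

definition overdominated :: "'a set set \<Rightarrow> 'a set \<Rightarrow> 'a \<Rightarrow> bool" where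
  "overdominated E S u \<longleftrightarrow> card (closed_nbhd E u \<inter> S) \<ge> 2"

definition CR_set :: "'a set \<Rightarrow> 'a set set \<Rightarrow> 'a set \<Rightarrow> nat" where
  "CR_set V E S = card {u \<in> V. overdominated E S u}"

text \<open>The whole vertex set is dominating, so the minima in the next two definitions are attained.\<close>

definition CR :: "'a set \<Rightarrow> 'a set set \<Rightarrow> nat" where
  "CR V E = (LEAST r. \<exists>S. dominating V E S \<and> CR_set V E S = r)"

definition gamma_CR :: "'a set \<Rightarrow> 'a set set \<Rightarrow> nat" where
  "gamma_CR V E = (LEAST s. \<exists>S. dominating V E S \<and> CR_set V E S = CR V E \<and> card S = s)"

text \<open>The graphs over which the minimum is taken have natural numbers as vertices; every finite graph
  is isomorphic to such a graph.\<close>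

definition admissible :: "nat \<Rightarrow> nat \<Rightarrow> nat \<Rightarrow> nat set \<Rightarrow> nat set set \<Rightarrow> bool" where
  "admissible n k m V E \<longleftrightarrow> simple_graph V E \<and> card V = n \<and> card E = m \<and> CR V E = k"

definition d :: "nat \<Rightarrow> nat \<Rightarrow> nat \<Rightarrow> nat" where
  "d n k m = (if \<exists>V E. admissible n k m V E
              then LEAST s. \<exists>V E. admissible n k m V E \<and> gamma_CR V E = s
              else 0)"

end

theory Submission
  imports Defs
begin

text \<open>A dominating set \<open>S\<close> of a graph with \<open>n\<close> vertices and \<open>m\<close> edges has at least \<open>n - m\<close> elements:
  every vertex outside \<open>S\<close> is joined to \<open>S\<close> by an edge, and these edges are distinct because exactly
  one endpoint of each lies outside \<open>S\<close> (lemma \<open>card_le_dominating\<close>). For \<open>n > 0\<close>, moreover, \<open>S\<close> is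
  nonempty. So \<open>max (n - m) 1\<close>, which is the claimed value, is a lower bound.

  The bound is attained by a star with isolated vertices or additional edges (lemma
  \<open>ex_efficiently_dominated_graph\<close>). If \<open>m < n - 1\<close>, the edges form a star with centre \<open>0\<close> and \<open>m\<close>
  leaves, and \<open>S\<close> consists of the centre and the \<open>n - m - 1\<close> isolated vertices. If \<open>m \<ge> n - 1\<close>, the
  graph contains a star with centre \<open>0\<close> spanning all vertices, and \<open>S\<close> is the centre alone. In
  both cases \<open>S\<close> overdominates no vertex, so the cardinality-redundance of the graph is \<open>0\<close>.\<close>

lemma simple_graph_finite_edges: "simple_graph V E \<Longrightarrow> finite E"
  unfolding simple_graph_def by (rule finite_subset[of _ "Pow V"]) auto

lemma dominating_vertex_set: "dominating V E V"
  unfolding dominating_def closed_nbhd_def by auto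

lemma not_overdominatedI:
  assumes "\<And>a b. a \<in> closed_nbhd E u \<inter> S \<Longrightarrow> b \<in> closed_nbhd E u \<inter> S \<Longrightarrow> a = b"
  shows "\<not> overdominated E S u"
proof
  assume over: "overdominated E S u"
  then have "finite (closed_nbhd E u \<inter> S)"
    unfolding overdominated_def by (intro card_ge_0_finite) simp
  then have "card (closed_nbhd E u \<inter> S) \<le> Suc 0"
    using assms by (simp add: card_le_Suc0_iff_eq)
  with over show False
    unfolding overdominated_def by simp
qed

lemma CR_set_eq_0I:
  assumes "\<And>u. u \<in> V \<Longrightarrow> \<not> overdominated E S u"
  shows "CR_set V E S = 0"
proof -
  have "{u \<in> V. overdominated E S u} = {}" using assms by blast
  then show ?thesis unfolding CR_set_def by (simp only: card.empty)
qed

lemma CR_attained: "\<exists>S. dominating V E S \<and> CR_set V E S = CR V E"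
  unfolding CR_def by (rule LeastI_ex) (use dominating_vertex_set in blast)

lemma gamma_CR_attained:
  "\<exists>S. dominating V E S \<and> CR_set V E S = CR V E \<and> card S = gamma_CR V E"
  unfolding gamma_CR_def by (rule LeastI_ex) (use CR_attained in blast)

lemma CR_eq_0:
  assumes "dominating V E S" and "CR_set V E S = 0"
  shows "CR V E = 0"
  unfolding CR_def by (rule Least_eq_0) (use assms in blast)

lemma gamma_CR_le:
  assumes "dominating V E S" and "CR_set V E S = CR V E"
  shows "gamma_CR V E \<le> card S"
  unfolding gamma_CR_def by (rule Least_le) (use assms in blast)

lemma card_le_dominating:
  assumes G: "simple_graph V E" and S: "dominating V E S"
  shows "card V \<le> card E + card S"
proof -
  have finV: "finite V" using G unfolding simple_graph_def by blast
  have SV: "S \<subseteq> V" using S unfolding dominating_def by blast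
  have "\<forall>v\<in>V - S. \<exists>s\<in>S. {s, v} \<in> E"
    using S unfolding dominating_def closed_nbhd_def by auto
  then obtain f where f: "\<And>v. v \<in> V - S \<Longrightarrow> f v \<in> S \<and> {f v, v} \<in> E"
    by metis
  have "inj_on (\<lambda>v. {f v, v}) (V - S)"
    using f by (auto intro!: inj_onI simp: doubleton_eq_iff)
  moreover have "(\<lambda>v. {f v, v}) ` (V - S) \<subseteq> E"
    using f by blast
  ultimately have "card (V - S) \<le> card E"
    using simple_graph_finite_edges[OF G] card_inj_on_le by blast
  moreover have "card (V - S) = card V - card S"
    using SV finV by (meson card_Diff_subset finite_subset)
  ultimately show ?thesis by simp
qed

lemma dominating_card_pos:
  assumes "finite V" and "V \<noteq> {}" and "dominating V E S"
  shows "card S > 0"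
proof -
  have "S \<noteq> {}" "finite S"
    using assms finite_subset unfolding dominating_def by auto
  then show ?thesis by (simp add: card_gt_0_iff)
qed

lemma ex_efficiently_dominated_graph:
  fixes n m :: nat
  assumes n: "n > 0" and m: "m \<le> n choose 2"
  shows "\<exists>(V :: nat set) E S. simple_graph V E \<and> card V = n \<and> card E = m
           \<and> dominating V E S \<and> CR_set V E S = 0 \<and> card S = max (n - m) 1"
proof -
  define V where "V = {..<n}"
  define leaves where "leaves = {0<..<n} \<inter> {..m}"
  define star where "star = (\<lambda>i. {0, i}) ` leaves"
  define pairs where "pairs = {e. e \<subseteq> V \<and> card e = 2}"
  define S where "S = insert 0 {m<..<n}"
  have leaves: "leaves = {0<..<min n (Suc m)}"
    unfolding leaves_def by auto
  have "inj_on (\<lambda>i. {0, i}) leaves"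
    by (auto intro!: inj_onI simp: doubleton_eq_iff)
  then have card_star: "card star = min (n - 1) m"
    unfolding star_def by (simp add: card_image leaves)
  have "finite V" unfolding V_def by simp
  have fin_pairs: "finite pairs"
    unfolding pairs_def by (rule finite_subset[of _ "Pow V"]) (use \<open>finite V\<close> in auto)
  have card_pairs: "card pairs = n choose 2"
    unfolding pairs_def using n_subsets[OF \<open>finite V\<close>, of 2] by (simp add: V_def)
  have "star \<subseteq> pairs"
    using n unfolding star_def pairs_def leaves_def V_def by auto
  moreover have "card star \<le> m" using card_star by simp
  ultimately obtain E where E: "star \<subseteq> E" "E \<subseteq> pairs" "card E = m"
    using exists_subset_between[of star m pairs] m fin_pairs card_pairs by metis
  have graph: "simple_graph V E"
    using E(2) \<open>finite V\<close> unfolding simple_graph_def pairs_def by auto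
  have dom: "dominating V E S"
    unfolding dominating_def
  proof (intro conjI ballI)
    show "S \<subseteq> V" using n unfolding S_def V_def by auto
    fix v assume "v \<in> V"
    show "\<exists>s\<in>S. v \<in> closed_nbhd E s"
    proof (cases "v \<in> leaves")
      case True
      then have "{0, v} \<in> E" using E(1) unfolding star_def by blast
      then show ?thesis unfolding S_def closed_nbhd_def by blast
    next
      case False
      then have "v \<in> S" using \<open>v \<in> V\<close> unfolding S_def V_def leaves_def by auto
      then show ?thesis unfolding closed_nbhd_def by blast
    qed
  qed
  have "\<not> overdominated E S u" for u
  proof (rule not_overdominatedI)
    fix a b assume ab: "a \<in> closed_nbhd E u \<inter> S" "b \<in> closed_nbhd E u \<inter> S"
    show "a = b"
    proof (cases "m < n - 1")
      case True
      have "finite E" using graph by (rule simple_graph_finite_edges)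
      \<comment> \<open>There are too few edges for anything but the star.\<close>
      then have "E = star"
        using E True card_star card_subset_eq[of E star] by simp
      with ab show ?thesis
        unfolding closed_nbhd_def star_def leaves_def S_def
        by (auto simp: doubleton_eq_iff)
    next
      case False
      then have "S = {0}" unfolding S_def by auto
      with ab show ?thesis by simp
    qed
  qed
  then have "CR_set V E S = 0" by (rule CR_set_eq_0I)
  moreover have "card S = max (n - m) 1"
    unfolding S_def by auto
  ultimately show ?thesis
    using graph dom E(3) unfolding V_def by (metis card_lessThan)
qed

theorem theorem3p6:
  fixes n m :: nat
  assumes "n \<ge> 2" and "m \<le> n choose 2"
  shows "d n 0 m = (if m < n - 1 then n - m else 1)"
proof -
  have lower: "max (n - m) 1 \<le> gamma_CR V E" if adm: "admissible n 0 m V E" for V E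
  proof -
    have G: "simple_graph V E" "card V = n" "card E = m"
      using adm unfolding admissible_def by auto
    obtain S where S: "dominating V E S" "card S = gamma_CR V E"
      using gamma_CR_attained by metis
    have "finite V" "V \<noteq> {}"
      using G \<open>n \<ge> 2\<close> unfolding simple_graph_def by auto
    then have "card S > 0"
      using S(1) by (rule dominating_card_pos)
    with card_le_dominating[OF G(1) S(1)] G S(2) show ?thesis by simp
  qed
  obtain V :: "nat set" and E S where G: "simple_graph V E" "card V = n" "card E = m"
    and S: "dominating V E S" "CR_set V E S = 0" "card S = max (n - m) 1"
    using ex_efficiently_dominated_graph[of n m] assms by auto
  have "CR V E = 0" using S(1,2) by (rule CR_eq_0)
  then have adm: "admissible n 0 m V E"
    using G unfolding admissible_def by simp
  have "gamma_CR V E \<le> max (n - m) 1"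
    using gamma_CR_le[OF S(1)] S \<open>CR V E = 0\<close> by simp
  from lower[OF adm] this have attained: "gamma_CR V E = max (n - m) 1" by (rule order_antisym[rotated])
  have "(LEAST s. \<exists>V E. admissible n 0 m V E \<and> gamma_CR V E = s) = max (n - m) 1"
    by (rule Least_equality) (use adm attained lower in blast)+
  then have "d n 0 m = max (n - m) 1"
    using adm unfolding d_def by auto
  then show ?thesis by auto
qed

end
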